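(* Let $\mathcal{Q}$ be a set of laws on $\mathcal{X}^{\mathbb{N}}$ locally dominated by a reference measure $\mathtt{R}$, and let $\widetilde{\mathcal{Q}}$ be the closed fork-convex hull of $\mathcal{Q}$. Then every $\mathcal{Q}$-NSM is in fact a $\widetilde{\mathcal{Q}}$-NSM. Thus a test based on a $\mathcal{Q}$-NSM is powerless against $\widetilde{\mathcal{Q}}\setminus\mathcal{Q}$: if $(L_t)$ is a $\mathcal{Q}$-NSM, then for every $\mathtt{P}\in\widetilde{\mathcal{Q}}\setminus\mathcal{Q}$ and $\alpha\in(0,1)$, $\mathtt{P}(\inf\{t\ge1:L_t\ge1/\alpha\}<\infty)\le\alpha$.
   Context: $\mathcal{X}$ is a measurable space; $(X_t)_{t\ge1}$ are the coordinates on $\mathcal{X}^{\mathbb{N}}$, $\mathcal{F}_0$ is trivial, $\mathcal{F}_t=\sigma(X_1,\dots,X_t)$. For a set $\mathcal{Q}$ of laws, a $\mathcal{Q}$-NSM is a nonnegative process $(M_t)_{t\ge0}$ adapted to $(\mathcal{F}_t)$ with $M_0=1$ and $\mathbb{E}_{\mathtt{Q}}[M_t\mid\mathcal{F}_s]\le M_s$ for all $s\le t$ and every $\mathtt{Q}\in\mathcal{Q}$. A law $\mathtt{P}$ is locally dominated by a probability measure $\mathtt{R}$ if $\mathtt{P}|_{\mathcal{F}_t}\ll\mathtt{R}|_{\mathcal{F}_t}$ for all $t\in\mathbb{N}$; its likelihood ratio process is $Z_t=\mathrm{d}\mathtt{P}|_{\mathcal{F}_t}/\mathrm{d}\mathtt{R}|_{\mathcal{F}_t}$.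 A set of laws is locally dominated by $\mathtt{R}$ if each of its elements is. A fork-convex combination of two locally dominated laws $\mathtt{Q},\mathtt{Q}'$ with likelihood ratio processes $(Z_t),(Z'_t)$ is a law $\mathtt{Q}''$ with likelihood ratio process $$Z''_t=\begin{cases}Z_t,&t\le s,\\ hZ_t+(1-h)Z_s\dfrac{Z'_t}{Z'_s},&t>s,\end{cases}$$ for some $s\in\{0,1,2,\dots\}$ and some $\mathcal{F}_s$-measurable random variable $h$ with values in $[0,1]$ and $h=1$ on $\{Z'_s=0\}$ (with the convention $0/0:=1$). A set of (locally dominated) laws is fork-convex if it contains every fork-convex combination of its elements. The fork-convex hull of a set is the intersection of all fork-convex sets containing it. The closed fork-convex hull is the closure of the fork-convex hull with respect to $L^1(\mathtt{R})$ convergence of the likelihood ratio processes at each fixed time $t\in\mathbb{N}$. *)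

theory Defs
  imports "HOL-Probability.Probability"
begin

text \<open>The path space is the product over the index set \<open>{1..}\<close>, so that the coordinate
  process is \<open>\<lambda>t \<omega>. \<omega> t\<close> for \<open>t \<ge> 1\<close>.\<close>

definition path_space :: "'a measure \<Rightarrow> (nat \<Rightarrow> 'a) measure" where
  "path_space X = PiM {1..} (\<lambda>_. X)"

definition coord_filtration :: "'a measure \<Rightarrow> nat \<Rightarrow> (nat \<Rightarrow> 'a) measure" where
  "coord_filtration X t =
     sigma (space (path_space X))
       {(\<lambda>\<omega>. \<omega> i) -` A \<inter> space (path_space X) | i A. i \<in> {1..t} \<and> A \<in> sets X}"

definition path_law :: "'a measure \<Rightarrow> (nat \<Rightarrow> 'a) measure \<Rightarrow> bool" where
  "path_law X P \<longleftrightarrow> prob_space P \<and> sets P = sets (path_space X)"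

text \<open>\<open>M t\<close> is nonnegative, so the extended nonnegative conditional expectation is used; it is
  meaningful without an integrability assumption (integrability follows from \<open>s = 0\<close>).\<close>

definition NSM ::
  "'a measure \<Rightarrow> (nat \<Rightarrow> 'a) measure set \<Rightarrow> (nat \<Rightarrow> (nat \<Rightarrow> 'a) \<Rightarrow> real) \<Rightarrow> bool" where
  "NSM X \<Q> M \<longleftrightarrow>
     (\<forall>t. \<forall>\<omega>\<in>space (path_space X). 0 \<le> M t \<omega>) \<and>
     (\<forall>t. M t \<in> borel_measurable (coord_filtration X t)) \<and>
     (\<forall>\<omega>\<in>space (path_space X). M 0 \<omega> = 1) \<and>
     (\<forall>Q\<in>\<Q>. \<forall>s t. s \<le> t \<longrightarrow>
        (AE \<omega> in Q. nn_cond_exp Q (coord_filtration X s) (\<lambda>\<omega>. ennreal (M t \<omega>)) \<omega>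
                      \<le> ennreal (M s \<omega>)))"

definition locally_dominated ::
  "'a measure \<Rightarrow> (nat \<Rightarrow> 'a) measure \<Rightarrow> (nat \<Rightarrow> 'a) measure \<Rightarrow> bool" where
  "locally_dominated X R P \<longleftrightarrow>
     (\<forall>t. absolutely_continuous (restr_to_subalg R (coord_filtration X t))
                               (restr_to_subalg P (coord_filtration X t)))"

definition dominated_laws ::
  "'a measure \<Rightarrow> (nat \<Rightarrow> 'a) measure \<Rightarrow> (nat \<Rightarrow> 'a) measure set" where
  "dominated_laws X R = {P. path_law X P \<and> locally_dominated X R P}"

text \<open>A real-valued version of the Radon--Nikodym derivative, which is finite almost everywhere.\<close>

definition likelihood_ratio ::
  "'a measure \<Rightarrow> (nat \<Rightarrow> 'a) measure \<Rightarrow> (nat \<Rightarrow> 'a) measure \<Rightarrow> nat \<Rightarrow> (nat \<Rightarrow> 'a) \<Rightarrow> real" where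
  "likelihood_ratio X R P t \<omega> =
     enn2real (RN_deriv (restr_to_subalg R (coord_filtration X t))
                        (restr_to_subalg P (coord_filtration X t)) \<omega>)"

definition ratio :: "real \<Rightarrow> real \<Rightarrow> real" where
  "ratio a b = (if a = 0 \<and> b = 0 then 1 else a / b)"

text \<open>Likelihood ratios are only determined up to null sets, so the defining identity is required
  almost everywhere. A different choice of versions does not change the notion: \<open>h\<close> may be
  redefined as 1 on a null set of \<open>coord_filtration X s\<close>. If \<open>Z'\<^sub>s = 0\<close> but
  \<open>Z'\<^sub>t \<noteq> 0\<close>, the quotient is multiplied by \<open>1 - h = 0\<close>.\<close>

definition fork_convex_combination ::
  "'a measure \<Rightarrow> (nat \<Rightarrow> 'a) measure \<Rightarrow> (nat \<Rightarrow> 'a) measure \<Rightarrow> (nat \<Rightarrow> 'a) measure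
     \<Rightarrow> (nat \<Rightarrow> 'a) measure \<Rightarrow> bool" where
  "fork_convex_combination X R Q Q' Q'' \<longleftrightarrow>
     Q'' \<in> dominated_laws X R \<and>
     (\<exists>s h. h \<in> borel_measurable (coord_filtration X s) \<and>
        (\<forall>\<omega>\<in>space (path_space X). h \<omega> \<in> {0..1}) \<and>
        (\<forall>\<omega>\<in>space (path_space X). likelihood_ratio X R Q' s \<omega> = 0 \<longrightarrow> h \<omega> = 1) \<and>
        (\<forall>t. AE \<omega> in R. likelihood_ratio X R Q'' t \<omega> =
           (if t \<le> s then likelihood_ratio X R Q t \<omega>
            else h \<omega> * likelihood_ratio X R Q t \<omega> +
                 (1 - h \<omega>) * likelihood_ratio X R Q s \<omega> *
                   ratio (likelihood_ratio X R Q' t \<omega>) (likelihood_ratio X R Q' s \<omega>))))"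

definition fork_convex ::
  "'a measure \<Rightarrow> (nat \<Rightarrow> 'a) measure \<Rightarrow> (nat \<Rightarrow> 'a) measure set \<Rightarrow> bool" where
  "fork_convex X R \<S> \<longleftrightarrow>
     \<S> \<subseteq> dominated_laws X R \<and>
     (\<forall>Q\<in>\<S>. \<forall>Q'\<in>\<S>. \<forall>Q''. fork_convex_combination X R Q Q' Q'' \<longrightarrow> Q'' \<in> \<S>)"

definition fork_convex_hull ::
  "'a measure \<Rightarrow> (nat \<Rightarrow> 'a) measure \<Rightarrow> (nat \<Rightarrow> 'a) measure set \<Rightarrow> (nat \<Rightarrow> 'a) measure set" where
  "fork_convex_hull X R \<Q> = \<Inter> {\<S>. fork_convex X R \<S> \<and> \<Q> \<subseteq> \<S>}"

text \<open>The mode of convergence is induced by countably many pseudometrics (one for each \<open>t\<close>), so the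
  closure consists of the limits of sequences.\<close>

definition closed_fork_convex_hull ::
  "'a measure \<Rightarrow> (nat \<Rightarrow> 'a) measure \<Rightarrow> (nat \<Rightarrow> 'a) measure set \<Rightarrow> (nat \<Rightarrow> 'a) measure set" where
  "closed_fork_convex_hull X R \<Q> =
     {P \<in> dominated_laws X R.
        \<exists>Pn :: nat \<Rightarrow> (nat \<Rightarrow> 'a) measure. (\<forall>n. Pn n \<in> fork_convex_hull X R \<Q>) \<and>
          (\<forall>t. (\<lambda>n. \<integral>\<^sup>+\<omega>. ennreal \<bar>likelihood_ratio X R (Pn n) t \<omega> - likelihood_ratio X R P t \<omega>\<bar> \<partial>R)
                 \<longlonglongrightarrow> 0)}"

lemma subalgebra_coord_filtration:
  assumes "sets P = sets (path_space X)"
  shows "subalgebra P (coord_filtration X t)"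
proof -
  have sp: "space P = space (path_space X)"
    using assms by (rule sets_eq_imp_space_eq)
  have sub: "{(\<lambda>\<omega>. \<omega> i) -` A \<inter> space (path_space X) | i A. i \<in> {1..t} \<and> A \<in> sets X}
      \<subseteq> sets (path_space X)"
    unfolding path_space_def by (auto intro!: measurable_sets[OF measurable_component_singleton])
  have "sets (coord_filtration X t) \<subseteq> sets (path_space X)"
    unfolding coord_filtration_def using sub sets.space_closed[of "path_space X"]
    by (subst sets_measure_of) (auto intro!: sets.sigma_sets_subset)
  moreover have "space (coord_filtration X t) = space (path_space X)"
    unfolding coord_filtration_def by (rule space_measure_of) auto
  ultimately show ?thesis
    using sp assms by (auto simp: subalgebra_def)
qed

lemma fork_convex_dominated_laws: "fork_convex X R (dominated_laws X R)"
  by (auto simp: fork_convex_def fork_convex_combination_def)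

end

theory Submission
  imports Defs
begin

text \<open>Tested against nonnegative \<open>\<F>\<^sub>s\<close>-measurable weights and written under \<open>R\<close>, the
  supermartingale inequality for a law with likelihood ratio \<open>Z\<close> reads
  \<open>\<integral> w M\<^sub>t Z\<^sub>t dR \<le> \<integral> w M\<^sub>s Z\<^sub>s dR\<close>. Beyond its fork time a fork-convex combination has the
  likelihood ratio \<open>h Z\<^sub>t + v Z'\<^sub>t\<close> with \<open>h\<close> and \<open>v = (1 - h) Z\<^sub>s / Z'\<^sub>s\<close> known at the fork time,
  so that both coefficients can be absorbed into the weight. Hence the laws under which \<open>M\<close> is a
  supermartingale form a fork-convex set. For limits, \<open>w\<close> is supported on \<open>{M\<^sub>s \<le> k}\<close> and \<open>M\<^sub>t\<close>
  is truncated, so that both sides are continuous in \<open>Z\<close> for \<open>L\<^sup>1(R)\<close>. The statement on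
  tests is Ville's inequality.\<close>

section \<open>The coordinate filtration and laws on path space\<close>

lemma space_coord_filtration [simp]: "space (coord_filtration X t) = space (path_space X)"
  unfolding coord_filtration_def by (rule space_measure_of) auto

lemma sets_coord_filtration_mono:
  assumes "s \<le> t"
  shows "sets (coord_filtration X s) \<subseteq> sets (coord_filtration X t)"
proof -
  have "{(\<lambda>\<omega>. \<omega> i) -` A \<inter> space (path_space X) | i A. i \<in> {1..s} \<and> A \<in> sets X}
      \<subseteq> {(\<lambda>\<omega>. \<omega> i) -` A \<inter> space (path_space X) | i A. i \<in> {1..t} \<and> A \<in> sets X}"
    using assms by fastforce
  then show ?thesis
    unfolding coord_filtration_def
    by (subst (1 2) sets_measure_of) (auto intro!: sigma_sets_mono')
qed

lemma measurable_coord_filtration_mono: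
  assumes "f \<in> measurable (coord_filtration X s) N" "s \<le> t"
  shows "f \<in> measurable (coord_filtration X t) N"
  using assms sets_coord_filtration_mono[OF assms(2), of X] unfolding measurable_def by auto

lemma measurable_path_law:
  assumes "path_law X P" "f \<in> measurable (coord_filtration X t) N"
  shows "f \<in> measurable P N"
  using measurable_from_subalg[OF subalgebra_coord_filtration assms(2)] assms(1)
  by (simp add: path_law_def)

lemma space_path_law: "path_law X P \<Longrightarrow> space P = space (path_space X)"
  using sets_eq_imp_space_eq[of P "path_space X"] by (simp add: path_law_def)

lemma sigma_finite_subalgebra_coord_filtration:
  assumes "path_law X P"
  shows "sigma_finite_subalgebra P (coord_filtration X t)"
proof -
  interpret prob_space P using assms by (simp add: path_law_def)
  interpret finite_measure_subalgebra P "coord_filtration X t"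
    using assms by unfold_locales (auto simp: path_law_def intro: subalgebra_coord_filtration)
  show ?thesis by unfold_locales
qed

section \<open>Likelihood ratios as densities at a fixed time\<close>

lemma measurable_likelihood_ratio:
  assumes "path_law X R"
  shows "likelihood_ratio X R P t \<in> borel_measurable (coord_filtration X t)"
proof -
  have sa: "subalgebra R (coord_filtration X t)"
    using assms by (auto simp: path_law_def intro: subalgebra_coord_filtration)
  show ?thesis
    unfolding likelihood_ratio_def
    by (rule measurable_in_subalg'[OF sa]) measurable
qed

lemma likelihood_ratio_nonneg [simp]: "0 \<le> likelihood_ratio X R P t \<omega>"
  by (simp add: likelihood_ratio_def)

text \<open>Change of measure at time \<open>t\<close>. Local domination provides a density only on
  \<F>_t, so the integral passes from \<open>P\<close> to its restriction, then to the restriction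
  of \<open>R\<close>, and back to \<open>R\<close>; each passage relies on \<open>f\<close> being
  \<F>_t-measurable.\<close>

lemma nn_integral_likelihood_ratio:
  assumes R: "path_law X R" and P: "P \<in> dominated_laws X R"
    and f: "f \<in> borel_measurable (coord_filtration X t)"
  shows "(\<integral>\<^sup>+\<omega>. f \<omega> \<partial>P) = (\<integral>\<^sup>+\<omega>. f \<omega> * ennreal (likelihood_ratio X R P t \<omega>) \<partial>R)"
proof -
  let ?F = "coord_filtration X t"
  let ?R = "restr_to_subalg R ?F" and ?P = "restr_to_subalg P ?F"
  have Pl: "path_law X P" and ac: "absolutely_continuous ?R ?P"
    using P by (auto simp: dominated_laws_def locally_dominated_def)
  have sR: "subalgebra R ?F" and sP: "subalgebra P ?F"
    using R Pl by (auto simp: path_law_def intro: subalgebra_coord_filtration)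
  interpret R: prob_space ?R
    using R sR prob_space_restr_to_subalg by (auto simp: path_law_def)
  interpret P: prob_space ?P
    using Pl sP prob_space_restr_to_subalg by (auto simp: path_law_def)
  have sets: "sets ?P = sets ?R"
    using sets_restr_to_subalg[OF sR] sets_restr_to_subalg[OF sP] by simp
  note [measurable] = f measurable_likelihood_ratio[OF R, of P t]
  have fR: "f \<in> borel_measurable ?R"
    by (rule measurable_in_subalg[OF sR f])
  \<comment> \<open>\<open>enn2real\<close> sends \<open>\<infinity>\<close> to 0, so finiteness
    almost everywhere is what lets \<open>likelihood_ratio\<close> stand in for
    \<open>RN_deriv\<close> under the integral.\<close>
  have fin: "AE \<omega> in ?R. RN_deriv ?R ?P \<omega> \<noteq> \<infinity>"
    by (rule R.RN_deriv_finite[OF _ ac sets]) unfold_locales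
  have "(\<integral>\<^sup>+\<omega>. f \<omega> \<partial>P) = (\<integral>\<^sup>+\<omega>. f \<omega> \<partial>?P)"
    by (rule nn_integral_subalgebra2[OF sP f, symmetric])
  also have "\<dots> = (\<integral>\<^sup>+\<omega>. RN_deriv ?R ?P \<omega> * f \<omega> \<partial>?R)"
    by (rule R.RN_deriv_nn_integral[OF ac sets fR])
  also have "\<dots> = (\<integral>\<^sup>+\<omega>. f \<omega> * ennreal (likelihood_ratio X R P t \<omega>) \<partial>?R)"
    using fin
    by (intro nn_integral_cong_AE) (auto simp: likelihood_ratio_def mult.commute less_top)
  also have "\<dots> = (\<integral>\<^sup>+\<omega>. f \<omega> * ennreal (likelihood_ratio X R P t \<omega>) \<partial>R)"
    by (intro nn_integral_subalgebra2[OF sR]) measurable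
  finally show ?thesis .
qed

section \<open>Conditional inequalities tested by weights\<close>

lemma (in sigma_finite_subalgebra) nn_cond_exp_le_weighted:
  assumes le: "AE x in M. nn_cond_exp M F f x \<le> g x"
    and f: "f \<in> borel_measurable M" and w: "w \<in> borel_measurable F"
  shows "(\<integral>\<^sup>+x. w x * f x \<partial>M) \<le> (\<integral>\<^sup>+x. w x * g x \<partial>M)"
proof -
  have "(\<integral>\<^sup>+x. w x * f x \<partial>M) = (\<integral>\<^sup>+x. w x * nn_cond_exp M F f x \<partial>M)"
    by (rule nn_cond_exp_intg[OF w f, symmetric])
  also have "\<dots> \<le> (\<integral>\<^sup>+x. w x * g x \<partial>M)"
    using le by (intro nn_integral_mono_AE) (auto elim!: eventually_mono intro: mult_left_mono)
  finally show ?thesis .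
qed

text \<open>Converse of the weighted inequality, with indicator weights on which \<open>g\<close> is
  bounded. The bound keeps the right-hand integral finite, so that integrals can be subtracted; it
  also spares later arguments from testing against an unbounded \<open>g\<close>.\<close>

lemma (in sigma_finite_subalgebra) nn_cond_exp_leI:
  fixes g :: "'a \<Rightarrow> real"
  assumes fin: "finite_measure M"
    and f: "f \<in> borel_measurable M" and g [measurable]: "g \<in> borel_measurable F"
    and le: "\<And>A k. A \<in> sets F \<Longrightarrow> (\<And>x. x \<in> A \<Longrightarrow> g x \<le> real k) \<Longrightarrow>
      (\<integral>\<^sup>+x. indicator A x * f x \<partial>M) \<le> (\<integral>\<^sup>+x. indicator A x * ennreal (g x) \<partial>M)"
  shows "AE x in M. nn_cond_exp M F f x \<le> ennreal (g x)"
proof -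
  interpret finite_measure M by fact
  let ?C = "nn_cond_exp M F f"
  have gM [measurable]: "g \<in> borel_measurable M"
    by (rule measurable_from_subalg[OF subalg g])
  have "AE x in M. g x \<le> real k \<longrightarrow> ?C x \<le> ennreal (g x)" for k
  proof -
    \<comment> \<open>The part of the exceptional set on which \<open>g\<close> is at most
      \<open>k\<close>; the claim amounts to \<open>A\<close> being null.\<close>
    define A where "A = {x \<in> space F. ennreal (g x) < ?C x \<and> g x \<le> real k}"
    have AF [measurable]: "A \<in> sets F"
      unfolding A_def by measurable
    have AM [measurable]: "A \<in> sets M"
      using AF subalg by (auto simp: subalgebra_def)
    have "(\<integral>\<^sup>+x. indicator A x * ?C x \<partial>M) = (\<integral>\<^sup>+x. indicator A x * f x \<partial>M)"
      by (rule nn_cond_exp_intg) (use f in measurable)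
    also have "\<dots> \<le> (\<integral>\<^sup>+x. indicator A x * ennreal (g x) \<partial>M)"
      by (rule le) (auto simp: A_def)
    finally have le': "(\<integral>\<^sup>+x. indicator A x * ?C x \<partial>M) \<le> (\<integral>\<^sup>+x. indicator A x * ennreal (g x) \<partial>M)" .
    have "(\<integral>\<^sup>+x. indicator A x * ennreal (g x) \<partial>M) \<le> (\<integral>\<^sup>+x. ennreal (real k) \<partial>M)"
      by (intro nn_integral_mono) (auto simp: A_def indicator_def intro: ennreal_leI)
    also have "\<dots> < \<infinity>"
      by (simp add: ennreal_mult_eq_top_iff less_top[symmetric])
    finally have fin: "(\<integral>\<^sup>+x. indicator A x * ennreal (g x) \<partial>M) \<noteq> \<infinity>"
      by simp
    have "(\<integral>\<^sup>+x. indicator A x * ?C x - indicator A x * ennreal (g x) \<partial>M) =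
        (\<integral>\<^sup>+x. indicator A x * ?C x \<partial>M) - (\<integral>\<^sup>+x. indicator A x * ennreal (g x) \<partial>M)"
    proof (rule nn_integral_diff)
      show "AE x in M. indicator A x * ennreal (g x) \<le> indicator A x * ?C x"
        by (auto simp: A_def indicator_def)
    qed (use fin in measurable)
    \<comment> \<open>Subtraction on \<open>ennreal\<close> is truncated at 0, so the tested
      inequality \<open>le'\<close> makes this difference vanish. The integrand is nonnegative,
      hence zero almost everywhere, although it is strictly positive on \<open>A\<close>.\<close>
    also have "\<dots> = 0"
      by (rule diff_eq_0_ennreal[OF _ le']) (use le' fin in \<open>auto simp: less_top intro: le_less_trans\<close>)
    finally have "AE x in M. indicator A x * ?C x - indicator A x * ennreal (g x) = 0"
      by (subst (asm) nn_integral_0_iff_AE) measurable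
    then show ?thesis
    proof (rule AE_mp, intro AE_I2 impI)
      fix x assume x: "x \<in> space M" "g x \<le> real k"
        and 0: "indicator A x * ?C x - indicator A x * ennreal (g x) = 0"
      show "?C x \<le> ennreal (g x)"
      proof (rule ccontr)
        assume "\<not> ?C x \<le> ennreal (g x)"
        then have "x \<in> A" and lt: "ennreal (g x) < ?C x"
          using x subalg by (auto simp: A_def subalgebra_def)
        then have "?C x - ennreal (g x) = 0" using 0 by simp
        with lt show False by (simp add: diff_eq_0_iff_ennreal leD)
      qed
    qed
  qed
  \<comment> \<open>Countably many null sets are collected; each real value \<open>g x\<close> lies
    below some natural number \<open>k\<close>.\<close>
  then have "AE x in M. \<forall>k. g x \<le> real k \<longrightarrow> ?C x \<le> ennreal (g x)"
    unfolding AE_all_countable by (rule allI)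
  then show ?thesis
  proof (rule AE_mp, intro AE_I2 impI)
    fix x assume "\<forall>k. g x \<le> real k \<longrightarrow> ?C x \<le> ennreal (g x)"
    moreover obtain k where "g x \<le> real k" using real_arch_simple by blast
    ultimately show "?C x \<le> ennreal (g x)" by blast
  qed
qed

section \<open>The supermartingale property expressed under the reference measure\<close>

text \<open>The part of \<open>NSM\<close> that mentions no law. Splitting it off reduces
  \<open>NSM\<close> for a set of laws to singletons, the empty set included.\<close>

definition nonneg_adapted :: "'a measure \<Rightarrow> (nat \<Rightarrow> (nat \<Rightarrow> 'a) \<Rightarrow> real) \<Rightarrow> bool" where
  "nonneg_adapted X M \<longleftrightarrow>
     (\<forall>t. \<forall>\<omega>\<in>space (path_space X). 0 \<le> M t \<omega>) \<and>
     (\<forall>t. M t \<in> borel_measurable (coord_filtration X t)) \<and>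
     (\<forall>\<omega>\<in>space (path_space X). M 0 \<omega> = 1)"

lemma NSM_iff_singletons:
  "NSM X \<Q> M \<longleftrightarrow> nonneg_adapted X M \<and> (\<forall>Q\<in>\<Q>. NSM X {Q} M)"
  by (auto simp: NSM_def nonneg_adapted_def)

lemma NSM_weighted:
  assumes P: "path_law X P" and M: "NSM X {P} M" and "s \<le> t"
    and w: "w \<in> borel_measurable (coord_filtration X s)"
  shows "(\<integral>\<^sup>+\<omega>. w \<omega> * ennreal (M t \<omega>) \<partial>P) \<le> (\<integral>\<^sup>+\<omega>. w \<omega> * ennreal (M s \<omega>) \<partial>P)"
proof -
  interpret sigma_finite_subalgebra P "coord_filtration X s"
    by (rule sigma_finite_subalgebra_coord_filtration[OF P])
  have "M t \<in> borel_measurable P"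
    using M by (intro measurable_path_law[OF P, of _ t]) (auto simp: NSM_def)
  then show ?thesis
    using M w \<open>s \<le> t\<close> by (intro nn_cond_exp_le_weighted) (auto simp: NSM_def)
qed

text \<open>Each side uses the likelihood ratio of its own time: \<open>w\<close> times
  \<open>M t\<close> is \<F>_t-measurable, while \<open>w\<close> times \<open>M s\<close> is
  already \<F>_s-measurable.\<close>

lemma NSM_likelihood_ratio_weighted:
  assumes R: "path_law X R" and P: "P \<in> dominated_laws X R" and M: "NSM X {P} M" and "s \<le> t"
    and w: "w \<in> borel_measurable (coord_filtration X s)"
  shows "(\<integral>\<^sup>+\<omega>. w \<omega> * ennreal (M t \<omega>) * ennreal (likelihood_ratio X R P t \<omega>) \<partial>R)
       \<le> (\<integral>\<^sup>+\<omega>. w \<omega> * ennreal (M s \<omega>) * ennreal (likelihood_ratio X R P s \<omega>) \<partial>R)"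
proof -
  have "M u \<in> borel_measurable (coord_filtration X u)" for u
    using M by (simp add: NSM_def)
  note [measurable] = this w measurable_coord_filtration_mono[OF w \<open>s \<le> t\<close>]
  have "path_law X P" using P by (simp add: dominated_laws_def)
  from NSM_weighted[OF this M \<open>s \<le> t\<close> w] show ?thesis
    by (subst (1 2) nn_integral_likelihood_ratio[OF R P, symmetric]) measurable
qed

text \<open>Combines the change of measure with \<open>nn_cond_exp_leI\<close>. Tests are confined
  to sets where \<open>M s\<close> is bounded, which is what the passage to L^1 limits
  requires.\<close>

lemma NSM_likelihood_ratioI:
  assumes R: "path_law X R" and P: "P \<in> dominated_laws X R" and M: "nonneg_adapted X M"
    and le: "\<And>s t A k. s \<le> t \<Longrightarrow> A \<in> sets (coord_filtration X s) \<Longrightarrow>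
      (\<And>\<omega>. \<omega> \<in> A \<Longrightarrow> M s \<omega> \<le> real k) \<Longrightarrow>
      (\<integral>\<^sup>+\<omega>. indicator A \<omega> * ennreal (M t \<omega>) * ennreal (likelihood_ratio X R P t \<omega>) \<partial>R)
       \<le> (\<integral>\<^sup>+\<omega>. indicator A \<omega> * ennreal (M s \<omega>) * ennreal (likelihood_ratio X R P s \<omega>) \<partial>R)"
  shows "NSM X {P} M"
proof -
  have Mm [measurable]: "M u \<in> borel_measurable (coord_filtration X u)" for u
    using M by (simp add: nonneg_adapted_def)
  have Pl: "path_law X P" using P by (simp add: dominated_laws_def)
  have "AE \<omega> in P. nn_cond_exp P (coord_filtration X s) (\<lambda>\<omega>. ennreal (M t \<omega>)) \<omega> \<le> ennreal (M s \<omega>)"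
    if "s \<le> t" for s t
  proof -
    interpret sigma_finite_subalgebra P "coord_filtration X s"
      by (rule sigma_finite_subalgebra_coord_filtration[OF Pl])
    have [measurable]: "M t \<in> borel_measurable P"
      by (rule measurable_path_law[OF Pl Mm])
    show ?thesis
    proof (rule nn_cond_exp_leI)
      show "finite_measure P" using Pl by (simp add: path_law_def prob_space.finite_measure)
      fix A k assume A: "A \<in> sets (coord_filtration X s)" and bound: "\<And>\<omega>. \<omega> \<in> A \<Longrightarrow> M s \<omega> \<le> real k"
      have [measurable]: "A \<in> sets (coord_filtration X s)" "A \<in> sets (coord_filtration X t)"
        using A sets_coord_filtration_mono[OF that, of X] by auto
      have "(\<integral>\<^sup>+\<omega>. indicator A \<omega> * ennreal (M t \<omega>) \<partial>P) =
          (\<integral>\<^sup>+\<omega>. indicator A \<omega> * ennreal (M t \<omega>) * ennreal (likelihood_ratio X R P t \<omega>) \<partial>R)"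
        by (rule nn_integral_likelihood_ratio[OF R P]) measurable
      also have "\<dots> \<le> (\<integral>\<^sup>+\<omega>. indicator A \<omega> * ennreal (M s \<omega>) * ennreal (likelihood_ratio X R P s \<omega>) \<partial>R)"
        by (rule le[OF that A bound])
      also have "\<dots> = (\<integral>\<^sup>+\<omega>. indicator A \<omega> * ennreal (M s \<omega>) \<partial>P)"
        by (rule nn_integral_likelihood_ratio[OF R P, symmetric]) measurable
      finally show "(\<integral>\<^sup>+\<omega>. indicator A \<omega> * ennreal (M t \<omega>) \<partial>P)
        \<le> (\<integral>\<^sup>+\<omega>. indicator A \<omega> * ennreal (M s \<omega>) \<partial>P)" .
    qed measurable
  qed
  then show ?thesis
    using M by (auto simp: NSM_def nonneg_adapted_def)
qed

section \<open>Fork-convex combinations and the fork-convex hull\<close>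

text \<open>The position of \<open>s\<close> and \<open>t\<close> relative to the fork time
  \<open>r\<close> decides. Up to \<open>r\<close> the inequality is that of \<open>Q\<close>; from
  \<open>r\<close> on it is a sum of those of \<open>Q\<close> and \<open>Q'\<close> with modified
  weights; across the fork the two are chained at time \<open>r\<close>.\<close>

lemma fork_convex_combination_NSM:
  assumes R: "path_law X R"
    and Q: "Q \<in> dominated_laws X R" "NSM X {Q} M"
    and Q': "Q' \<in> dominated_laws X R" "NSM X {Q'} M"
    and comb: "fork_convex_combination X R Q Q' Q''"
  shows "NSM X {Q''} M"
proof -
  define Z where "Z = likelihood_ratio X R Q"
  define Z' where "Z' = likelihood_ratio X R Q'"
  define Z'' where "Z'' = likelihood_ratio X R Q''"
  have Zm: "Z t \<in> borel_measurable (coord_filtration X t)"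
    "Z' t \<in> borel_measurable (coord_filtration X t)" for t
    using measurable_likelihood_ratio[OF R] by (auto simp: Z_def Z'_def)
  have Zp [simp]: "0 \<le> Z t \<omega>" "0 \<le> Z' t \<omega>" for t \<omega>
    by (auto simp: Z_def Z'_def)
  have Mm: "M t \<in> borel_measurable (coord_filtration X t)" for t
    using Q by (simp add: NSM_def)
  have Q'': "Q'' \<in> dominated_laws X R"
    using comb by (simp add: fork_convex_combination_def)
  obtain r h where h: "h \<in> borel_measurable (coord_filtration X r)"
    and h01: "\<And>\<omega>. \<omega> \<in> space (path_space X) \<Longrightarrow> 0 \<le> h \<omega> \<and> h \<omega> \<le> 1"
    and h1: "\<And>\<omega>. \<omega> \<in> space (path_space X) \<Longrightarrow> Z' r \<omega> = 0 \<Longrightarrow> h \<omega> = 1"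
    and eq: "\<And>t. AE \<omega> in R. Z'' t \<omega> = (if t \<le> r then Z t \<omega>
        else h \<omega> * Z t \<omega> + (1 - h \<omega>) * Z r \<omega> * ratio (Z' t \<omega>) (Z' r \<omega>))"
    using comb unfolding fork_convex_combination_def Z_def Z'_def Z''_def by auto
  \<comment> \<open>Division by zero yields 0, so \<open>v\<close> vanishes on {\<open>Z' r\<close>
    = 0}; there \<open>h\<close> is 1, which is consistent.\<close>
  define v where "v = (\<lambda>\<omega>. (1 - h \<omega>) * Z r \<omega> / Z' r \<omega>)"
  have v: "v \<in> borel_measurable (coord_filtration X r)"
    unfolding v_def using h Zm by measurable
  have v0: "0 \<le> v \<omega>" if "\<omega> \<in> space (path_space X)" for \<omega>
    using h01[OF that] by (simp add: v_def)
  have before: "AE \<omega> in R. Z'' t \<omega> = Z t \<omega>" if "t \<le> r" for t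
    using eq[of t] that by simp
  \<comment> \<open>The case \<open>t = r\<close> is included on purpose: there the formula
    collapses to \<open>Z r\<close>, so \<open>r\<close> is a common endpoint of both
    regimes.\<close>
  have after: "AE \<omega> in R. ennreal (Z'' t \<omega>) =
      ennreal (h \<omega>) * ennreal (Z t \<omega>) + ennreal (v \<omega>) * ennreal (Z' t \<omega>)" if "r \<le> t" for t
    using eq[of t]
  proof (rule AE_mp, intro AE_I2 impI)
    fix \<omega> assume "\<omega> \<in> space R"
      and e: "Z'' t \<omega> = (if t \<le> r then Z t \<omega>
        else h \<omega> * Z t \<omega> + (1 - h \<omega>) * Z r \<omega> * ratio (Z' t \<omega>) (Z' r \<omega>))"
    then have \<omega>: "\<omega> \<in> space (path_space X)" using space_path_law[OF R] by simp
    have "Z'' t \<omega> = h \<omega> * Z t \<omega> + v \<omega> * Z' t \<omega>"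
    \<comment> \<open>If \<open>Z' r\<close> vanishes, then \<open>h\<close> is 1 and
      \<open>v\<close> is 0, so the value of \<open>ratio\<close> is irrelevant. Otherwise
      \<open>ratio\<close> is an ordinary quotient, and for \<open>t = r\<close> the factor
      \<open>Z' r\<close> cancels.\<close>
    proof (cases "Z' r \<omega> = 0")
      case True
      then show ?thesis using e h1[OF \<omega>] by (simp add: v_def)
    next
      case False
      show ?thesis
      proof (cases "t = r")
        case True
        then show ?thesis using e False by (simp add: v_def field_simps)
      next
        case False
        then show ?thesis using e \<open>Z' r \<omega> \<noteq> 0\<close> that by (simp add: v_def ratio_def)
      qed
    qed
    then show "ennreal (Z'' t \<omega>) =
      ennreal (h \<omega>) * ennreal (Z t \<omega>) + ennreal (v \<omega>) * ennreal (Z' t \<omega>)"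
      using h01[OF \<omega>] v0[OF \<omega>] by (simp add: ennreal_mult)
  qed
  have le_after: "(\<integral>\<^sup>+\<omega>. w \<omega> * ennreal (M t \<omega>) * ennreal (Z'' t \<omega>) \<partial>R)
      \<le> (\<integral>\<^sup>+\<omega>. w \<omega> * ennreal (M s \<omega>) * ennreal (Z'' s \<omega>) \<partial>R)"
    if "r \<le> s" "s \<le> t" and w: "w \<in> borel_measurable (coord_filtration X s)" for s t w
  proof -
    \<comment> \<open>Since \<open>r \<le> s\<close>, both coefficients are known at time
      \<open>s\<close>, so \<open>w\<close> times \<open>h\<close> and \<open>w\<close> times
      \<open>v\<close> are admissible weights for \<open>Q\<close> and \<open>Q'\<close>.\<close>
    have hs: "h \<in> borel_measurable (coord_filtration X s)"
      and vs: "v \<in> borel_measurable (coord_filtration X s)"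
      using h v that by (auto intro: measurable_coord_filtration_mono)
    have hR [measurable]: "h \<in> borel_measurable R" "v \<in> borel_measurable R" "w \<in> borel_measurable R"
      "M u \<in> borel_measurable R" "Z u \<in> borel_measurable R" "Z' u \<in> borel_measurable R" for u
      using measurable_path_law[OF R] h v w Mm Zm by blast+
    have split: "(\<integral>\<^sup>+\<omega>. w \<omega> * ennreal (M u \<omega>) * ennreal (Z'' u \<omega>) \<partial>R) =
        (\<integral>\<^sup>+\<omega>. (w \<omega> * ennreal (h \<omega>)) * ennreal (M u \<omega>) * ennreal (Z u \<omega>) \<partial>R) +
        (\<integral>\<^sup>+\<omega>. (w \<omega> * ennreal (v \<omega>)) * ennreal (M u \<omega>) * ennreal (Z' u \<omega>) \<partial>R)" if "r \<le> u" for u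
    proof -
      have "(\<integral>\<^sup>+\<omega>. w \<omega> * ennreal (M u \<omega>) * ennreal (Z'' u \<omega>) \<partial>R) =
        (\<integral>\<^sup>+\<omega>. (w \<omega> * ennreal (h \<omega>)) * ennreal (M u \<omega>) * ennreal (Z u \<omega>) +
          (w \<omega> * ennreal (v \<omega>)) * ennreal (M u \<omega>) * ennreal (Z' u \<omega>) \<partial>R)"
        using after[OF that]
        by (intro nn_integral_cong_AE) (auto elim!: eventually_mono simp: distrib_left mult_ac)
      also have "\<dots> = (\<integral>\<^sup>+\<omega>. (w \<omega> * ennreal (h \<omega>)) * ennreal (M u \<omega>) * ennreal (Z u \<omega>) \<partial>R) +
        (\<integral>\<^sup>+\<omega>. (w \<omega> * ennreal (v \<omega>)) * ennreal (M u \<omega>) * ennreal (Z' u \<omega>) \<partial>R)"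
        by (rule nn_integral_add) measurable
      finally show ?thesis .
    qed
    have 1: "(\<integral>\<^sup>+\<omega>. (w \<omega> * ennreal (h \<omega>)) * ennreal (M t \<omega>) * ennreal (Z t \<omega>) \<partial>R)
        \<le> (\<integral>\<^sup>+\<omega>. (w \<omega> * ennreal (h \<omega>)) * ennreal (M s \<omega>) * ennreal (Z s \<omega>) \<partial>R)"
      unfolding Z_def
      by (rule NSM_likelihood_ratio_weighted[OF R Q \<open>s \<le> t\<close>]) (use w hs in measurable)
    have 2: "(\<integral>\<^sup>+\<omega>. (w \<omega> * ennreal (v \<omega>)) * ennreal (M t \<omega>) * ennreal (Z' t \<omega>) \<partial>R)
        \<le> (\<integral>\<^sup>+\<omega>. (w \<omega> * ennreal (v \<omega>)) * ennreal (M s \<omega>) * ennreal (Z' s \<omega>) \<partial>R)"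
      unfolding Z'_def
      by (rule NSM_likelihood_ratio_weighted[OF R Q' \<open>s \<le> t\<close>]) (use w vs in measurable)
    show ?thesis
      using split[of t] split[of s] that add_mono[OF 1 2] by simp
  qed
  have le_before: "(\<integral>\<^sup>+\<omega>. w \<omega> * ennreal (M t \<omega>) * ennreal (Z'' t \<omega>) \<partial>R)
      \<le> (\<integral>\<^sup>+\<omega>. w \<omega> * ennreal (M s \<omega>) * ennreal (Z'' s \<omega>) \<partial>R)"
    if "s \<le> t" "t \<le> r" and w: "w \<in> borel_measurable (coord_filtration X s)" for s t w
  proof -
    have "(\<integral>\<^sup>+\<omega>. w \<omega> * ennreal (M u \<omega>) * ennreal (Z'' u \<omega>) \<partial>R) =
      (\<integral>\<^sup>+\<omega>. w \<omega> * ennreal (M u \<omega>) * ennreal (Z u \<omega>) \<partial>R)" if "u \<le> r" for u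
      using before[OF that] by (intro nn_integral_cong_AE) auto
    from this[of s] this[of t] show ?thesis
      using NSM_likelihood_ratio_weighted[OF R Q \<open>s \<le> t\<close> w] that by (simp add: Z_def)
  qed
  show ?thesis
  proof (rule NSM_likelihood_ratioI[OF R Q''], fold Z''_def)
    show "nonneg_adapted X M" using Q(2) NSM_iff_singletons by blast
  next
    fix s t :: nat and A assume "s \<le> t" and A: "A \<in> sets (coord_filtration X s)"
    let ?w = "indicator A :: (nat \<Rightarrow> 'a) \<Rightarrow> ennreal"
    have w: "?w \<in> borel_measurable (coord_filtration X s)"
      using A by measurable
    consider "r \<le> s" | "t \<le> r" | "s \<le> r" "r \<le> t" by linarith
    then show "(\<integral>\<^sup>+\<omega>. ?w \<omega> * ennreal (M t \<omega>) * ennreal (Z'' t \<omega>) \<partial>R)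
       \<le> (\<integral>\<^sup>+\<omega>. ?w \<omega> * ennreal (M s \<omega>) * ennreal (Z'' s \<omega>) \<partial>R)"
    proof cases
      case 1
      then show ?thesis by (rule le_after[OF _ \<open>s \<le> t\<close> w])
    next
      case 2
      then show ?thesis by (rule le_before[OF \<open>s \<le> t\<close> _ w])
    next
      case 3
      \<comment> \<open>The weight is known at time \<open>s \<le> r\<close>, hence also at
        \<open>r\<close>, and can be used from \<open>r\<close> to \<open>t\<close> as well as from
        \<open>s\<close> to \<open>r\<close>.\<close>
      from le_after[OF order_refl 3(2) measurable_coord_filtration_mono[OF w 3(1)]]
        le_before[OF 3(1) order_refl w]
      show ?thesis by (rule order_trans)
    qed
  qed
qed

text \<open>The dominated laws under which \<open>M\<close> is a supermartingale are a fork-convex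
  set containing \<open>\<Q>\<close>, hence one of the sets intersected in the hull.\<close>

lemma fork_convex_hull_NSM:
  assumes R: "path_law X R" and \<Q>: "\<Q> \<subseteq> dominated_laws X R"
    and M: "NSM X \<Q> M" and P: "P \<in> fork_convex_hull X R \<Q>"
  shows "P \<in> dominated_laws X R" "NSM X {P} M"
proof -
  let ?S = "{P \<in> dominated_laws X R. NSM X {P} M}"
  have "fork_convex X R ?S"
    unfolding fork_convex_def
  proof (intro conjI ballI allI impI)
    fix Q Q' Q'' assume "Q \<in> ?S" "Q' \<in> ?S" and comb: "fork_convex_combination X R Q Q' Q''"
    then have "NSM X {Q''} M"
      by (intro fork_convex_combination_NSM[OF R _ _ _ _ comb]) auto
    moreover have "Q'' \<in> dominated_laws X R"
      using comb by (simp add: fork_convex_combination_def)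
    ultimately show "Q'' \<in> ?S" by simp
  qed auto
  moreover have "\<Q> \<subseteq> ?S"
    using \<Q> M NSM_iff_singletons[of X \<Q> M] by auto
  ultimately have "P \<in> ?S"
    using P unfolding fork_convex_hull_def by blast
  then show "P \<in> dominated_laws X R" "NSM X {P} M" by auto
qed

section \<open>Stability under L^1 limits of likelihood ratios\<close>

text \<open>From \<open>z\<close> \<le> \<open>z'\<close> + |\<open>z\<close> - \<open>z'\<close>|
  and the bound \<open>c\<close> on the weight. The estimate is one-sided, so it can be used to move
  either from the limit to the approximating density or back.\<close>

lemma nn_integral_bounded_weight_perturb:
  assumes [measurable]: "a \<in> borel_measurable N" "z \<in> borel_measurable N" "z' \<in> borel_measurable N"
    and a: "\<And>x. x \<in> space N \<Longrightarrow> a x \<le> c" and nonneg: "\<And>x. 0 \<le> z' x"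
  shows "(\<integral>\<^sup>+x. a x * ennreal (z x) \<partial>N) \<le>
    (\<integral>\<^sup>+x. a x * ennreal (z' x) \<partial>N) + c * (\<integral>\<^sup>+x. ennreal \<bar>z x - z' x\<bar> \<partial>N)"
proof -
  have "(\<integral>\<^sup>+x. a x * ennreal (z x) \<partial>N) \<le> (\<integral>\<^sup>+x. a x * ennreal (z' x) + c * ennreal \<bar>z x - z' x\<bar> \<partial>N)"
  proof (rule nn_integral_mono)
    fix x assume x: "x \<in> space N"
    have "ennreal (z x) \<le> ennreal (z' x + \<bar>z x - z' x\<bar>)"
      by (rule ennreal_leI) auto
    also have "\<dots> = ennreal (z' x) + ennreal \<bar>z x - z' x\<bar>"
      by (rule ennreal_plus) (auto simp: nonneg)
    finally have "a x * ennreal (z x) \<le> a x * ennreal (z' x) + a x * ennreal \<bar>z x - z' x\<bar>"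
      by (metis distrib_left mult_left_mono zero_le)
    also have "\<dots> \<le> a x * ennreal (z' x) + c * ennreal \<bar>z x - z' x\<bar>"
      using a[OF x] by (intro add_left_mono mult_right_mono) auto
    finally show "a x * ennreal (z x) \<le> a x * ennreal (z' x) + c * ennreal \<bar>z x - z' x\<bar>" .
  qed
  also have "\<dots> = (\<integral>\<^sup>+x. a x * ennreal (z' x) \<partial>N) + c * (\<integral>\<^sup>+x. ennreal \<bar>z x - z' x\<bar> \<partial>N)"
    by (simp add: nn_integral_add nn_integral_cmult)
  finally show ?thesis .
qed

text \<open>The density of the limit is replaced by that of \<open>Pn n\<close> at time
  \<open>t\<close>, the inequality for \<open>Pn n\<close> is applied, and the density is replaced
  back at time \<open>s\<close>. First \<open>n\<close> tends to infinity with the truncation level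
  \<open>j\<close> fixed, then \<open>j\<close> does.\<close>

lemma closed_fork_convex_hull_NSM:
  assumes R: "path_law X R" and \<Q>: "\<Q> \<subseteq> dominated_laws X R"
    and M: "NSM X \<Q> M" and P: "P \<in> closed_fork_convex_hull X R \<Q>"
  shows "NSM X {P} M"
proof -
  obtain Pn where Pn: "\<And>n. Pn n \<in> fork_convex_hull X R \<Q>"
    and conv: "\<And>t. (\<lambda>n. \<integral>\<^sup>+\<omega>. ennreal \<bar>likelihood_ratio X R (Pn n) t \<omega> - likelihood_ratio X R P t \<omega>\<bar> \<partial>R)
                 \<longlonglongrightarrow> 0"
    and PD: "P \<in> dominated_laws X R"
    using P by (auto simp: closed_fork_convex_hull_def)
  have Pn': "Pn n \<in> dominated_laws X R" "NSM X {Pn n} M" for n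
    using fork_convex_hull_NSM[OF R \<Q> M Pn] by auto
  have na: "nonneg_adapted X M" using M NSM_iff_singletons by blast
  define Z where "Z = likelihood_ratio X R P"
  define Y where "Y = (\<lambda>n. likelihood_ratio X R (Pn n))"
  define e where "e = (\<lambda>n t. \<integral>\<^sup>+\<omega>. ennreal \<bar>Y n t \<omega> - Z t \<omega>\<bar> \<partial>R)"
  have [measurable]: "Z t \<in> borel_measurable R" "Y n t \<in> borel_measurable R" for t n
    using measurable_path_law[OF R measurable_likelihood_ratio[OF R]] by (auto simp: Z_def Y_def)
  have [simp]: "0 \<le> Z t \<omega>" "0 \<le> Y n t \<omega>" for t n \<omega>
    by (auto simp: Z_def Y_def)
  have Mm: "M t \<in> borel_measurable (coord_filtration X t)" for t
    using na by (simp add: nonneg_adapted_def)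
  have [measurable]: "M t \<in> borel_measurable R" for t
    by (rule measurable_path_law[OF R Mm])
  have e0: "(\<lambda>n. e n t) \<longlonglongrightarrow> 0" for t
    using conv by (simp add: e_def Y_def Z_def)
  show ?thesis
  proof (rule NSM_likelihood_ratioI[OF R PD na], fold Z_def)
    fix s t k :: nat and A assume "s \<le> t" and A: "A \<in> sets (coord_filtration X s)"
      and bound: "\<And>\<omega>. \<omega> \<in> A \<Longrightarrow> M s \<omega> \<le> real k"
    have [measurable]: "A \<in> sets R"
      using A R subalgebra_coord_filtration[of R X s] by (auto simp: path_law_def subalgebra_def)
    let ?I = "indicator A :: (nat \<Rightarrow> 'a) \<Rightarrow> ennreal"
    let ?rhs = "\<integral>\<^sup>+\<omega>. ?I \<omega> * ennreal (M s \<omega>) * ennreal (Z s \<omega>) \<partial>R"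
    \<comment> \<open>Two perturbations cost \<open>j * e n t\<close> and \<open>k * e n s\<close>:
      the left weight is at most \<open>j\<close> by truncation, the right one at most
      \<open>k\<close> by the choice of \<open>A\<close>. Both costs vanish in the limit since
      \<open>j\<close> and \<open>k\<close> are finite.\<close>
    have trunc: "(\<integral>\<^sup>+\<omega>. ?I \<omega> * min (ennreal (M t \<omega>)) (of_nat j) * ennreal (Z t \<omega>) \<partial>R) \<le> ?rhs" for j
    proof -
      have "(\<integral>\<^sup>+\<omega>. ?I \<omega> * min (ennreal (M t \<omega>)) (of_nat j) * ennreal (Z t \<omega>) \<partial>R)
          \<le> ?rhs + of_nat k * e n s + of_nat j * e n t" for n
      proof -
        have "(\<integral>\<^sup>+\<omega>. ?I \<omega> * min (ennreal (M t \<omega>)) (of_nat j) * ennreal (Z t \<omega>) \<partial>R)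
          \<le> (\<integral>\<^sup>+\<omega>. ?I \<omega> * min (ennreal (M t \<omega>)) (of_nat j) * ennreal (Y n t \<omega>) \<partial>R) +
            of_nat j * (\<integral>\<^sup>+\<omega>. ennreal \<bar>Z t \<omega> - Y n t \<omega>\<bar> \<partial>R)"
          by (rule nn_integral_bounded_weight_perturb) (auto simp: indicator_def)
        also have "(\<integral>\<^sup>+\<omega>. ?I \<omega> * min (ennreal (M t \<omega>)) (of_nat j) * ennreal (Y n t \<omega>) \<partial>R)
          \<le> (\<integral>\<^sup>+\<omega>. ?I \<omega> * ennreal (M t \<omega>) * ennreal (Y n t \<omega>) \<partial>R)"
          by (intro nn_integral_mono mult_right_mono mult_left_mono) auto
        also have "\<dots> \<le> (\<integral>\<^sup>+\<omega>. ?I \<omega> * ennreal (M s \<omega>) * ennreal (Y n s \<omega>) \<partial>R)"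
          unfolding Y_def
          by (rule NSM_likelihood_ratio_weighted[OF R Pn' \<open>s \<le> t\<close>]) (use A in measurable)
        also have "\<dots> \<le> ?rhs + of_nat k * e n s"
          unfolding e_def
          by (rule nn_integral_bounded_weight_perturb)
            (auto simp: indicator_def ennreal_of_nat_eq_real_of_nat intro!: ennreal_leI bound)
        finally show ?thesis
          by (simp add: e_def abs_minus_commute add_right_mono)
      qed
      moreover have "(\<lambda>n. ?rhs + of_nat k * e n s + of_nat j * e n t) \<longlonglongrightarrow> ?rhs + of_nat k * 0 + of_nat j * 0"
        by (intro tendsto_add tendsto_const ennreal_tendsto_cmult e0)
          (auto simp: ennreal_of_nat_eq_real_of_nat)
      ultimately show ?thesis
        by (intro LIMSEQ_le_const[of _ ?rhs]) auto
    qed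
    \<comment> \<open>As \<open>M t\<close> is real-valued, some truncation level already reaches
      it; monotone convergence then removes the truncation.\<close>
    have "ennreal (M t \<omega>) = (SUP j. min (ennreal (M t \<omega>)) (of_nat j))" for \<omega>
    proof (rule antisym)
      obtain j where "M t \<omega> \<le> real j" using real_arch_simple by blast
      then have "ennreal (M t \<omega>) \<le> min (ennreal (M t \<omega>)) (of_nat j)"
        by (simp add: ennreal_of_nat_eq_real_of_nat ennreal_leI)
      then show "ennreal (M t \<omega>) \<le> (SUP j. min (ennreal (M t \<omega>)) (of_nat j))"
        by (rule SUP_upper2[OF UNIV_I])
    qed (auto intro: SUP_least)
    then have "(\<integral>\<^sup>+\<omega>. ?I \<omega> * ennreal (M t \<omega>) * ennreal (Z t \<omega>) \<partial>R) =
      (\<integral>\<^sup>+\<omega>. (SUP j. ?I \<omega> * min (ennreal (M t \<omega>)) (of_nat j) * ennreal (Z t \<omega>)) \<partial>R)"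
      by (simp add: SUP_mult_left_ennreal[symmetric] SUP_mult_right_ennreal[symmetric])
    also have "\<dots> = (SUP j. \<integral>\<^sup>+\<omega>. ?I \<omega> * min (ennreal (M t \<omega>)) (of_nat j) * ennreal (Z t \<omega>) \<partial>R)"
      by (rule nn_integral_monotone_convergence_SUP)
        (auto simp: incseq_def le_fun_def intro!: mult_right_mono mult_left_mono min.mono)
    also have "\<dots> \<le> ?rhs"
      by (rule SUP_least) (rule trunc)
    finally show "(\<integral>\<^sup>+\<omega>. ?I \<omega> * ennreal (M t \<omega>) * ennreal (Z t \<omega>) \<partial>R) \<le> ?rhs" .
  qed
qed

section \<open>Ville's inequality\<close>

text \<open>In place of optional stopping, the process is frozen at the value \<open>c\<close> once
  the level has been reached. Its mean stays at most 1 by induction on the horizon, and Markov's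
  bound applies at each horizon.\<close>

lemma NSM_Ville:
  assumes P: "path_law X P" and L: "NSM X {P} L" and c: "0 < c"
  shows "measure P {\<omega> \<in> space P. \<exists>t\<ge>1. c \<le> L t \<omega>} \<le> 1 / c"
proof -
  interpret prob_space P using P by (simp add: path_law_def)
  have sp: "space P = space (path_space X)" by (rule space_path_law[OF P])
  have Lm: "L t \<in> borel_measurable (coord_filtration X t)" for t
    using L by (simp add: NSM_def)
  have [measurable]: "L t \<in> borel_measurable P" for t
    by (rule measurable_path_law[OF P Lm])
  \<comment> \<open>The level is reached between times 1 and \<open>T\<close>. Thus
    \<open>H 0\<close> is empty, and the induction starts from \<open>L 0\<close> = 1.\<close>
  define H where "H = (\<lambda>T. {\<omega> \<in> space P. \<exists>t\<in>{1..T}. c \<le> L t \<omega>})"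
  have [measurable]: "H T \<in> sets P" for T
    unfolding H_def by measurable
  have HF: "H T \<in> sets (coord_filtration X T)" for T
  proof -
    have [measurable]: "L t \<in> borel_measurable (coord_filtration X T)" if "t \<in> {1..T}" for t
      using that Lm by (auto intro: measurable_coord_filtration_mono)
    have "H T = (\<Union>t\<in>{1..T}. {\<omega> \<in> space (coord_filtration X T). c \<le> L t \<omega>})"
      by (auto simp: H_def sp)
    also have "\<dots> \<in> sets (coord_filtration X T)"
      by (intro sets.finite_UN) measurable
    finally show ?thesis .
  qed
  have bound: "(\<integral>\<^sup>+\<omega>. ennreal c * indicator (H T) \<omega> + indicator (- H T) \<omega> * ennreal (L T \<omega>) \<partial>P) \<le> 1" for T
  proof (induction T)
    case 0
    have "(\<integral>\<^sup>+\<omega>. ennreal c * indicator (H 0) \<omega> + indicator (- H 0) \<omega> * ennreal (L 0 \<omega>) \<partial>P) = (\<integral>\<^sup>+\<omega>. 1 \<partial>P)"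
      using L by (intro nn_integral_cong) (auto simp: H_def NSM_def sp)
    then show ?case by (simp add: emeasure_space_1)
  next
    case (Suc T)
    \<comment> \<open>On paths that first reach the level at \<open>Suc T\<close>, the value
      \<open>L (Suc T)\<close> is at least \<open>c\<close>, so freezing there only lowers the
      integrand.\<close>
    have "(\<integral>\<^sup>+\<omega>. ennreal c * indicator (H (Suc T)) \<omega> + indicator (- H (Suc T)) \<omega> * ennreal (L (Suc T) \<omega>) \<partial>P)
      \<le> (\<integral>\<^sup>+\<omega>. ennreal c * indicator (H T) \<omega> + indicator (- H T) \<omega> * ennreal (L (Suc T) \<omega>) \<partial>P)"
    proof (rule nn_integral_mono)
      fix \<omega> assume "\<omega> \<in> space P"
      then have "\<omega> \<in> H (Suc T) \<longleftrightarrow> \<omega> \<in> H T \<or> c \<le> L (Suc T) \<omega>"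
        by (auto simp: H_def atLeastAtMostSuc_conv)
      then show "ennreal c * indicator (H (Suc T)) \<omega> + indicator (- H (Suc T)) \<omega> * ennreal (L (Suc T) \<omega>)
        \<le> ennreal c * indicator (H T) \<omega> + indicator (- H T) \<omega> * ennreal (L (Suc T) \<omega>)"
        by (auto simp: indicator_def intro: ennreal_leI)
    qed
    also have "\<dots> = (\<integral>\<^sup>+\<omega>. ennreal c * indicator (H T) \<omega> \<partial>P) + (\<integral>\<^sup>+\<omega>. indicator (- H T) \<omega> * ennreal (L (Suc T) \<omega>) \<partial>P)"
      by (rule nn_integral_add) measurable
    \<comment> \<open>Not having reached the level by time \<open>T\<close> is an \<F>_T event
      (\<open>HF\<close>), so its indicator is a valid weight for the step from \<open>T\<close> to
      \<open>Suc T\<close>.\<close>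
    also have "\<dots> \<le> (\<integral>\<^sup>+\<omega>. ennreal c * indicator (H T) \<omega> \<partial>P) + (\<integral>\<^sup>+\<omega>. indicator (- H T) \<omega> * ennreal (L T \<omega>) \<partial>P)"
      by (intro add_left_mono NSM_weighted[OF P L]) (use HF[of T] in measurable)
    also have "\<dots> = (\<integral>\<^sup>+\<omega>. ennreal c * indicator (H T) \<omega> + indicator (- H T) \<omega> * ennreal (L T \<omega>) \<partial>P)"
      by (rule nn_integral_add[symmetric]) measurable
    finally show ?case using Suc.IH by (rule order_trans)
  qed
  have "prob (H T) \<le> 1 / c" for T
  proof -
    have "ennreal (c * prob (H T)) = (\<integral>\<^sup>+\<omega>. ennreal c * indicator (H T) \<omega> \<partial>P)"
      using c by (simp add: nn_integral_cmult emeasure_eq_measure ennreal_mult)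
    also have "\<dots> \<le> (\<integral>\<^sup>+\<omega>. ennreal c * indicator (H T) \<omega> + indicator (- H T) \<omega> * ennreal (L T \<omega>) \<partial>P)"
      by (intro nn_integral_mono) auto
    also have "\<dots> \<le> 1" by (rule bound)
    finally have "c * prob (H T) \<le> 1" by simp
    then show ?thesis using c by (simp add: field_simps)
  qed
  \<comment> \<open>The events \<open>H T\<close> increase to the event of ever reaching the level,
    so the uniform bound survives by continuity from below.\<close>
  moreover have "(\<lambda>T. prob (H T)) \<longlonglongrightarrow> prob (\<Union>T. H T)"
    by (rule finite_Lim_measure_incseq) (auto simp: incseq_def H_def)
  moreover have "(\<Union>T. H T) = {\<omega> \<in> space P. \<exists>t\<ge>1. c \<le> L t \<omega>}"
    by (fastforce simp: H_def)
  ultimately show ?thesis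
    using LIMSEQ_le_const2 by metis
qed

theorem theorem13:
  fixes X :: "'a measure"
    and R :: "(nat \<Rightarrow> 'a) measure"
    and \<Q> :: "(nat \<Rightarrow> 'a) measure set"
  assumes "path_law X R"
    and "\<forall>Q\<in>\<Q>. path_law X Q \<and> locally_dominated X R Q"
  shows "(\<forall>M. NSM X \<Q> M \<longrightarrow> NSM X (closed_fork_convex_hull X R \<Q>) M) \<and>
    (\<forall>L. NSM X \<Q> L \<longrightarrow>
       (\<forall>P \<in> closed_fork_convex_hull X R \<Q> - \<Q>. \<forall>\<alpha>::real. 0 < \<alpha> \<and> \<alpha> < 1 \<longrightarrow>
          measure P {\<omega> \<in> space P. (INF t\<in>{t. 1 \<le> t \<and> L t \<omega> \<ge> 1 / \<alpha>}. enat t) < \<infinity>} \<le> \<alpha>))"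
proof (intro conjI allI impI ballI)
  have \<Q>: "\<Q> \<subseteq> dominated_laws X R"
    using assms(2) by (auto simp: dominated_laws_def)
  note hull = closed_fork_convex_hull_NSM[OF assms(1) \<Q>]
  show "NSM X (closed_fork_convex_hull X R \<Q>) M" if "NSM X \<Q> M" for M
    using that hull[OF that] NSM_iff_singletons by metis
  fix L P and \<alpha> :: real
  assume L: "NSM X \<Q> L" and P: "P \<in> closed_fork_convex_hull X R \<Q> - \<Q>" and \<alpha>: "0 < \<alpha> \<and> \<alpha> < 1"
  have "path_law X P"
    using P by (auto simp: closed_fork_convex_hull_def dominated_laws_def)
  moreover have "NSM X {P} L"
    using hull[OF L] P by auto
  ultimately have "measure P {\<omega> \<in> space P. \<exists>t\<ge>1. 1 / \<alpha> \<le> L t \<omega>} \<le> 1 / (1 / \<alpha>)"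
    using \<alpha> by (intro NSM_Ville) auto
  \<comment> \<open>In \<open>enat\<close> the infimum of the empty set is
    \<open>\<infinity>\<close>, so the hitting time is finite exactly when the level is reached at
    some \<open>t \<ge> 1\<close>.\<close>
  moreover have "(INF t\<in>{t. 1 \<le> t \<and> L t \<omega> \<ge> 1 / \<alpha>}. enat t) < \<infinity> \<longleftrightarrow> (\<exists>t\<ge>1. 1 / \<alpha> \<le> L t \<omega>)" for \<omega>
    by (subst INF_less_iff) auto
  ultimately show "measure P {\<omega> \<in> space P. (INF t\<in>{t. 1 \<le> t \<and> L t \<omega> \<ge> 1 / \<alpha>}. enat t) < \<infinity>} \<le> \<alpha>"
    by simp
qed

end
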